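(* Let $T$ be a rooted, countably infinite tree without terminal vertices. Let $1\leqslant p\leqslant\infty$, let $q$ be the conjugate exponent of $p$ (that is, $\frac1p+\frac1q=1$), and let $\varphi:T\to\mathbb C$ be a function in $\mathcal L^q(T)$ such that $\varphi'\in\mathcal L^q(T)$ and the Toeplitz operator $T_\varphi$ is bounded on $\mathcal L^p(T)$. Then $T_\varphi$ has finite rank on $\mathcal L^p(T)$ if and only if $\varphi(v)=0$ for all but finitely many $v\in T$.
   Context: A tree $T$ is a locally finite graph (every vertex has finitely many neighbors) in which any two vertices are joined by exactly one path (a finite sequence of distinct, successively adjacent vertices); $T$ is identified with its set of vertices. The set of vertices is countably infinite, and a distinguished vertex $o$ is called the root. A terminal vertex is a vertex with exactly one neighbor; $T$ is assumed to have none. A vertex $w$ is a descendant of $v$ if $v$ lies on the path from $o$ to $w$. For $v\neq o$, $v^-$ denotes the unique neighbor of $v$ lying on the path from $o$ to $v$ (the parent of $v$). The sector $S_v$ is the set consisting of $v$ and all its descendants. For $1\leqslant p<\infty$, $\mathcal L^p(T)$ is the Banach space of functions $f:T\to\mathbb C$ with $\|f\|_p=\big(\sum_{v\in T}|f(v)|^p\big)^{1/p}<\infty$; $\mathcal L^\infty(T)$ is the Banach space of bounded functions $f:T\to\mathbb C$ with the supremum norm. The conjugate exponent of $p=1$ is $q=\infty$ and that of $p=\infty$ is $q=1$. For $\varphi:T\to\mathbb C$, define $\varphi_-(v)=\varphi(v^-)$ if $v\ne o$, $\varphi_-(o)=0$, and $\varphi'(v)=\varphi(v)-\varphi_-(v)$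 for all $v\in T$ (so $\varphi'(o)=\varphi(o)$). For any $f:T\to\mathbb C$, define $(\nabla f)(u)=f(u)-\sum_{v:\,v^-=u}f(v)$, $u\in T$. For $f\in\mathcal L^1(T)$, define $(\Delta f)(u)=\sum_{v\in S_u}f(v)$, $u\in T$. The Toeplitz operator with symbol $\varphi$ on $\mathcal L^p(T)$ is $T_\varphi f=\Delta(\varphi\nabla f)$, $f\in\mathcal L^p(T)$. (It is known that $\varphi\nabla f\in\mathcal L^1(T)$ whenever $\varphi,\varphi'\in\mathcal L^q(T)$ and $f\in\mathcal L^p(T)$, with $q$ conjugate to $p$, so that this is well defined.) "Bounded on $\mathcal L^p(T)$" means that $T_\varphi$ maps $\mathcal L^p(T)$ into itself and is a bounded linear operator; "finite rank" means that the range of $T_\varphi$ is finite-dimensional. *)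

theory Defs
  imports "HOL-Analysis.Analysis" "HOL-Library.Function_Algebras"
begin

text \<open>
  The vertices of a graph are all elements of the type \<open>'a\<close>; a simple graph is given by its
  adjacency relation.
\<close>

definition path_between :: "('a \<Rightarrow> 'a \<Rightarrow> bool) \<Rightarrow> 'a \<Rightarrow> 'a list \<Rightarrow> 'a \<Rightarrow> bool" where
  "path_between E u xs v \<longleftrightarrow>
     xs \<noteq> [] \<and> hd xs = u \<and> last xs = v \<and> distinct xs \<and> successively E xs"

definition is_tree :: "('a \<Rightarrow> 'a \<Rightarrow> bool) \<Rightarrow> bool" where
  "is_tree E \<longleftrightarrow> symp E \<and> irreflp E \<and> (\<forall>v. finite {w. E v w}) \<and>
     (\<forall>u v. \<exists>!xs. path_between E u xs v)"

definition terminal :: "('a \<Rightarrow> 'a \<Rightarrow> bool) \<Rightarrow> 'a \<Rightarrow> bool" where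
  "terminal E v \<longleftrightarrow> (\<exists>!w. E v w)"

definition the_path :: "('a \<Rightarrow> 'a \<Rightarrow> bool) \<Rightarrow> 'a \<Rightarrow> 'a \<Rightarrow> 'a list" where
  "the_path E u v = (THE xs. path_between E u xs v)"

text \<open>In all that follows \<open>r\<close> is the root.\<close>

definition descendant :: "('a \<Rightarrow> 'a \<Rightarrow> bool) \<Rightarrow> 'a \<Rightarrow> 'a \<Rightarrow> 'a \<Rightarrow> bool" where
  "descendant E r v w \<longleftrightarrow> v \<in> set (the_path E r w)"

definition parent :: "('a \<Rightarrow> 'a \<Rightarrow> bool) \<Rightarrow> 'a \<Rightarrow> 'a \<Rightarrow> 'a" where
  "parent E r v = (THE u. E v u \<and> u \<in> set (the_path E r v))"

definition children :: "('a \<Rightarrow> 'a \<Rightarrow> bool) \<Rightarrow> 'a \<Rightarrow> 'a \<Rightarrow> 'a set" where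
  "children E r u = {v. v \<noteq> r \<and> parent E r v = u}"

definition sector :: "('a \<Rightarrow> 'a \<Rightarrow> bool) \<Rightarrow> 'a \<Rightarrow> 'a \<Rightarrow> 'a set" where
  "sector E r v = insert v {w. descendant E r v w}"

definition Lp_space :: "ennreal \<Rightarrow> ('a \<Rightarrow> complex) set" where
  "Lp_space p =
     (if p = \<infinity> then {f. bounded (range f)}
      else {f. (\<lambda>v. norm (f v) powr enn2real p) summable_on UNIV})"

text \<open>Meaningful for elements of \<open>Lp_space p\<close> only.\<close>

definition Lp_norm :: "ennreal \<Rightarrow> ('a \<Rightarrow> complex) \<Rightarrow> real" where
  "Lp_norm p f =
     (if p = \<infinity> then (SUP v. norm (f v))
      else (\<Sum>\<^sub>\<infinity>v. norm (f v) powr enn2real p) powr (1 / enn2real p))"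

definition tree_derivative :: "('a \<Rightarrow> 'a \<Rightarrow> bool) \<Rightarrow> 'a \<Rightarrow> ('a \<Rightarrow> complex) \<Rightarrow> 'a \<Rightarrow> complex" where
  "tree_derivative E r \<phi> v = \<phi> v - (if v = r then 0 else \<phi> (parent E r v))"

definition nabla :: "('a \<Rightarrow> 'a \<Rightarrow> bool) \<Rightarrow> 'a \<Rightarrow> ('a \<Rightarrow> complex) \<Rightarrow> 'a \<Rightarrow> complex" where
  "nabla E r f u = f u - (\<Sum>v\<in>children E r u. f v)"

text \<open>Only applied to absolutely summable functions, for which the unordered sum exists.\<close>

definition Delta :: "('a \<Rightarrow> 'a \<Rightarrow> bool) \<Rightarrow> 'a \<Rightarrow> ('a \<Rightarrow> complex) \<Rightarrow> 'a \<Rightarrow> complex" where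
  "Delta E r f u = (\<Sum>\<^sub>\<infinity>v\<in>sector E r u. f v)"

definition toeplitz ::
  "('a \<Rightarrow> 'a \<Rightarrow> bool) \<Rightarrow> 'a \<Rightarrow> ('a \<Rightarrow> complex) \<Rightarrow> ('a \<Rightarrow> complex) \<Rightarrow> 'a \<Rightarrow> complex" where
  "toeplitz E r \<phi> f = Delta E r (\<lambda>v. \<phi> v * nabla E r f v)"

interpretation cfun: vector_space "\<lambda>(c::complex) (f::'a \<Rightarrow> complex) v. c * f v"
  by unfold_locales (auto simp: algebra_simps)

text \<open>
  The operators below are total functions of which only the restriction to \<open>Lp_space p\<close> matters.
\<close>

definition bounded_operator_on :: "ennreal \<Rightarrow> (('a \<Rightarrow> complex) \<Rightarrow> 'a \<Rightarrow> complex) \<Rightarrow> bool" where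
  "bounded_operator_on p A \<longleftrightarrow>
     A ` Lp_space p \<subseteq> Lp_space p \<and>
     (\<forall>f\<in>Lp_space p. \<forall>g\<in>Lp_space p. A (\<lambda>v. f v + g v) = (\<lambda>v. A f v + A g v)) \<and>
     (\<forall>c. \<forall>f\<in>Lp_space p. A (\<lambda>v. c * f v) = (\<lambda>v. c * A f v)) \<and>
     (\<exists>K. \<forall>f\<in>Lp_space p. Lp_norm p (A f) \<le> K * Lp_norm p f)"

definition finite_rank_on :: "ennreal \<Rightarrow> (('a \<Rightarrow> complex) \<Rightarrow> 'a \<Rightarrow> complex) \<Rightarrow> bool" where
  "finite_rank_on p A \<longleftrightarrow> (\<exists>B. finite B \<and> cfun.span B = A ` Lp_space p)"

end

theory Submission
  imports Defs
begin

text \<open>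
  The indicator function of the vertices on the path from the root to \<open>v\<close> has finite support, is
  mapped by \<open>\<nabla>\<close> to the indicator of \<open>{v}\<close>, and hence is an eigenvector of the Toeplitz operator
  with eigenvalue \<open>\<phi> v\<close>. These indicators are linearly independent, so finite rank forces
  \<open>\<phi> v \<noteq> 0\<close> for only finitely many \<open>v\<close>. Conversely, the range is contained in the span of the
  indicators with \<open>\<phi> v \<noteq> 0\<close>.
\<close>

section \<open>Paths from the root\<close>

lemma path_between_the_path:
  assumes "is_tree E"
  shows "path_between E u (the_path E u v) v"
  using assms unfolding is_tree_def the_path_def by (metis (mono_tags, lifting) theI')

lemma the_path_eqI:
  assumes "is_tree E" "path_between E u xs v"
  shows "the_path E u v = xs"
  using assms path_between_the_path[OF assms(1), of u v] unfolding is_tree_def by blast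

lemma path_between_prefix:
  "path_between E u (xs @ w # ys) v \<Longrightarrow> path_between E u (xs @ [w]) w"
  by (auto simp: path_between_def successively_append_iff hd_append split: if_splits)

lemma path_between_snoc:
  "path_between E u xs w \<Longrightarrow> E w v \<Longrightarrow> v \<notin> set xs \<Longrightarrow> path_between E u (xs @ [v]) v"
  by (auto simp: path_between_def successively_append_iff)

text \<open>An initial segment of a path is a path, and paths with given ends are unique. This lets
  the tree order be handled as the prefix order on the lists \<open>the_path E r v\<close>.\<close>

lemma the_path_prefix:
  assumes "is_tree E" "the_path E r v = xs @ w # ys"
  shows "the_path E r w = xs @ [w]"
proof (rule the_path_eqI[OF assms(1)])
  have "path_between E r (xs @ w # ys) v"
    using path_between_the_path[OF assms(1)] assms(2) by metis
  then show "path_between E r (xs @ [w]) w"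
    by (rule path_between_prefix)
qed

lemma the_path_root:
  assumes "is_tree E"
  shows "the_path E r r = [r]"
  by (rule the_path_eqI[OF assms]) (auto simp: path_between_def)

lemma last_the_path:
  assumes "is_tree E"
  shows "\<exists>xs. the_path E r v = xs @ [v]"
  using path_between_the_path[OF assms, of r v] unfolding path_between_def
  by (metis append_butlast_last_id)

lemma mem_the_path_iff:
  assumes "is_tree E"
  shows "u \<in> set (the_path E r v) \<longleftrightarrow> (\<exists>ys. the_path E r v = the_path E r u @ ys)"
proof
  assume "u \<in> set (the_path E r v)"
  then obtain xs ys where "the_path E r v = xs @ u # ys"
    by (meson split_list)
  with the_path_prefix[OF assms this] show "\<exists>ys. the_path E r v = the_path E r u @ ys"
    by simp
next
  assume "\<exists>ys. the_path E r v = the_path E r u @ ys"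
  with last_the_path[OF assms, of r u] show "u \<in> set (the_path E r v)"
    by auto
qed

text \<open>A neighbor \<open>w\<close> of \<open>v\<close> on the path to \<open>v\<close> must
  come last but one: cutting the path at \<open>w\<close> and stepping directly to \<open>v\<close>
  gives another path from the root to \<open>v\<close>, which uniqueness forces to be the
  same.\<close>

lemma parent_eq:
  assumes "is_tree E" "the_path E r v = xs @ [u, v]"
  shows "parent E r v = u"
  unfolding parent_def
proof (rule the_equality)
  have path: "path_between E r (xs @ [u, v]) v"
    using path_between_the_path[OF assms(1)] assms(2) by metis
  have sym: "E x y \<Longrightarrow> E y x" and irr: "\<not> E x x" for x y
    using assms(1) by (auto simp: is_tree_def symp_def irreflp_def)
  show "E v u \<and> u \<in> set (the_path E r v)"
    using path sym assms(2) by (auto simp: path_between_def successively_append_iff)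
  fix w assume w: "E v w \<and> w \<in> set (the_path E r v)"
  then have "w \<in> set (xs @ [u])"
    using assms(2) irr by auto
  then obtain as bs where split: "xs @ [u] = as @ w # bs"
    by (meson split_list)
  then have "xs @ [u, v] = as @ w # bs @ [v]"
    by simp
  with path have path': "path_between E r (as @ w # bs @ [v]) v"
    by metis
  \<comment> \<open>The path is distinct and ends in \<open>v\<close>, so \<open>v\<close> does not
    occur in the segment up to \<open>w\<close>.\<close>
  have "path_between E r (as @ [w]) w" "v \<notin> set (as @ [w])"
    using path' path_between_prefix[OF path'] by (auto simp: path_between_def)
  then have "path_between E r ((as @ [w]) @ [v]) v"
    using w sym by (intro path_between_snoc) auto
  then have "(as @ [w]) @ [v] = xs @ [u, v]"
    using the_path_eqI[OF assms(1)] assms(2) by metis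
  then show "w = u" by simp
qed

text \<open>Replaces the description operator in \<open>parent\<close> by a list equation. For
  \<open>w\<close> other than the root the path has at least two vertices, and
  \<open>parent_eq\<close> identifies the last but one.\<close>

lemma mem_children_iff:
  assumes "is_tree E"
  shows "w \<in> children E r u \<longleftrightarrow> the_path E r w = the_path E r u @ [w]"
proof
  assume w: "w \<in> children E r u"
  obtain xs where xs: "the_path E r w = xs @ [w]"
    using last_the_path[OF assms] by blast
  moreover have "hd (the_path E r w) = r"
    using path_between_the_path[OF assms, of r w] by (simp add: path_between_def)
  ultimately have "xs \<noteq> []"
    using w by (auto simp: children_def)
  then obtain ys y where "xs = ys @ [y]"
    using rev_exhaust by blast
  with xs have path: "the_path E r w = ys @ [y, w]" by simp
  then have "y = u"
    using parent_eq[OF assms path] w by (simp add: children_def)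
  then show "the_path E r w = the_path E r u @ [w]"
    using path the_path_prefix[OF assms, of r w ys y "[w]"] by simp
next
  assume path: "the_path E r w = the_path E r u @ [w]"
  obtain xs where "the_path E r u = xs @ [u]"
    using last_the_path[OF assms] by blast
  with path have "the_path E r w = xs @ [u, w]" by simp
  then have "parent E r w = u" "w \<noteq> r"
    using parent_eq[OF assms] the_path_root[OF assms, of r] by auto
  then show "w \<in> children E r u"
    by (simp add: children_def)
qed

text \<open>Follows from local finiteness. It makes the sum in \<open>nabla\<close> a genuine one
  rather than the default value 0 of a sum over an infinite set.\<close>

lemma finite_children:
  assumes "is_tree E"
  shows "finite (children E r u)"
proof (rule finite_subset)
  show "children E r u \<subseteq> {w. E u w}"
  proof
    fix w assume "w \<in> children E r u"
    then have path: "the_path E r w = the_path E r u @ [w]"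
      using mem_children_iff[OF assms] by metis
    obtain xs where "the_path E r u = xs @ [u]"
      using last_the_path[OF assms] by blast
    with path path_between_the_path[OF assms, of r w] show "w \<in> {w. E u w}"
      by (auto simp: path_between_def successively_append_iff)
  qed
  show "finite {w. E u w}"
    using assms by (simp add: is_tree_def)
qed

text \<open>The child of \<open>u\<close> on the way to \<open>v\<close> is the list entry right
  after the path to \<open>u\<close>, so there is at most one.\<close>

lemma child_mem_the_path_iff:
  assumes "is_tree E"
  shows "w \<in> children E r u \<and> w \<in> set (the_path E r v) \<longleftrightarrow>
    (\<exists>ys. the_path E r v = the_path E r u @ w # ys)"
proof
  assume "w \<in> children E r u \<and> w \<in> set (the_path E r v)"
  then show "\<exists>ys. the_path E r v = the_path E r u @ w # ys"
    using mem_children_iff[OF assms] mem_the_path_iff[OF assms] by fastforce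
next
  assume "\<exists>ys. the_path E r v = the_path E r u @ w # ys"
  then obtain ys where "the_path E r v = the_path E r u @ w # ys" ..
  then show "w \<in> children E r u \<and> w \<in> set (the_path E r v)"
    using mem_children_iff[OF assms] the_path_prefix[OF assms] by fastforce
qed

lemma sector_eq:
  assumes "is_tree E"
  shows "sector E r u = {v. u \<in> set (the_path E r v)}"
  using last_the_path[OF assms, of r u] by (auto simp: sector_def descendant_def)

section \<open>Indicator functions of paths\<close>

text \<open>This is \<open>Delta\<close> of the point mass at \<open>v\<close>. The variable
  \<open>u\<close> is the apex of the sector, so the support is the path from the root to
  \<open>v\<close>, not a sector.\<close>

definition path_indicator :: "('a \<Rightarrow> 'a \<Rightarrow> bool) \<Rightarrow> 'a \<Rightarrow> 'a \<Rightarrow> 'a \<Rightarrow> complex" where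
  "path_indicator E r v u = of_bool (v \<in> sector E r u)"

text \<open>The sum in \<open>nabla\<close> counts the children of \<open>u\<close> on the path to
  \<open>v\<close>: one if \<open>u\<close> lies strictly before \<open>v\<close> on it, which
  cancels the value at \<open>u\<close>, and none otherwise.\<close>

lemma nabla_path_indicator:
  assumes "is_tree E"
  shows "nabla E r (path_indicator E r v) u = of_bool (u = v)"
proof -
  let ?C = "{w \<in> children E r u. w \<in> set (the_path E r v)}"
  have C: "?C = {w. \<exists>ys. the_path E r v = the_path E r u @ w # ys}"
    using child_mem_the_path_iff[OF assms] by auto
  have "(\<Sum>w\<in>children E r u. path_indicator E r v w) = of_nat (card ?C)"
    using finite_children[OF assms, of r u]
    by (simp add: path_indicator_def sector_eq[OF assms] Int_def)
  then have nabla: "nabla E r (path_indicator E r v) u =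
      of_bool (u \<in> set (the_path E r v)) - of_nat (card ?C)"
    by (simp add: nabla_def path_indicator_def sector_eq[OF assms])
  \<comment> \<open>Either \<open>u\<close> is off the path, or it is the end \<open>v\<close>, or
    the path continues from \<open>u\<close> to some \<open>w\<close>.\<close>
  consider "u \<notin> set (the_path E r v)"
    | "the_path E r v = the_path E r u"
    | w ys where "the_path E r v = the_path E r u @ w # ys"
    using mem_the_path_iff[OF assms] by (metis append_Nil2 neq_Nil_conv)
  then show ?thesis
  proof cases
    case 1
    then have "?C = {}"
      unfolding C using mem_the_path_iff[OF assms] by blast
    moreover have "u \<noteq> v"
      using 1 last_the_path[OF assms, of r v] by auto
    ultimately show ?thesis
      using nabla 1 by simp
  next
    case 2
    then have "u = v"
      using last_the_path[OF assms] by (metis last_snoc)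
    moreover have "?C = {}"
      unfolding C using 2 by simp
    moreover have "u \<in> set (the_path E r v)"
      using 2 mem_the_path_iff[OF assms] by (metis append_Nil2)
    ultimately show ?thesis
      using nabla by simp
  next
    case 3
    then have "?C = {w}"
      unfolding C by auto
    moreover have "u \<in> set (the_path E r v)"
      using 3 mem_the_path_iff[OF assms] by blast
    moreover have "u \<noteq> v"
      using 3 by auto
    ultimately show ?thesis
      using nabla by simp
  qed
qed

lemma inj_path_indicator:
  assumes "is_tree E"
  shows "inj (path_indicator E r)"
proof
  fix v w assume "path_indicator E r v = path_indicator E r w"
  then have "of_bool (v = v) = (of_bool (v = w) :: complex)"
    using nabla_path_indicator[OF assms] by metis
  then show "v = w"
    by (cases "v = w") auto
qed

text \<open>Linearity of \<open>nabla\<close>, with coefficients indexed by the functions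
  themselves, as in the explicit description of linear dependence.\<close>

lemma nabla_sum:
  "nabla E r (\<Sum>g\<in>t. (\<lambda>x. c g * g x)) u = (\<Sum>g\<in>t. c g * nabla E r g u)"
proof -
  have apply_sum: "(\<Sum>g\<in>t. (\<lambda>x. c g * g x)) x = (\<Sum>g\<in>t. c g * g x)" for x
    by (induction t rule: infinite_finite_induct) auto
  have "(\<Sum>v\<in>children E r u. \<Sum>g\<in>t. c g * g v) = (\<Sum>g\<in>t. c g * (\<Sum>v\<in>children E r u. g v))"
    by (subst sum.swap) (simp add: sum_distrib_left)
  then show ?thesis
    by (simp add: nabla_def apply_sum right_diff_distrib sum_subtractf)
qed

text \<open>\<open>nabla\<close> turns path indicators into point masses. Applied to a vanishing
  combination and evaluated at \<open>v\<close>, it isolates the coefficient of the indicator of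
  \<open>v\<close>.\<close>

lemma independent_path_indicators:
  assumes "is_tree E"
  shows "\<not> cfun.dependent (path_indicator E r ` S)"
proof
  assume "cfun.dependent (path_indicator E r ` S)"
  then obtain t c g where t: "finite t" "t \<subseteq> path_indicator E r ` S"
    and zero: "(\<Sum>g\<in>t. (\<lambda>x. c g * g x)) = 0" and g: "g \<in> t" "c g \<noteq> 0"
    unfolding cfun.dependent_explicit by blast
  obtain v where v: "g = path_indicator E r v"
    using g t by blast
  have "nabla E r h v = of_bool (h = g)" if "h \<in> t" for h
  proof -
    obtain w where "h = path_indicator E r w"
      using \<open>h \<in> t\<close> t by blast
    then show ?thesis
      using v nabla_path_indicator[OF assms] inj_eq[OF inj_path_indicator[OF assms]] by auto
  qed
  then have "(\<Sum>h\<in>t. c h * nabla E r h v) = (\<Sum>h\<in>t. if h = g then c h else 0)"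
    by (intro sum.cong) auto
  also have "\<dots> = c g"
    using t g by (simp add: sum.delta)
  finally have "nabla E r 0 v = c g"
    using nabla_sum[of E r c t v] zero by simp
  with g show False
    by (simp add: nabla_def)
qed

text \<open>The assumption concerns the product so that it covers two cases: \<open>f\<close> a path
  indicator, where \<open>nabla E r f\<close> vanishes off one vertex, and arbitrary
  \<open>f\<close> with \<open>\<phi>\<close> of finite support.\<close>

lemma toeplitz_finite_support:
  assumes "finite A" "\<And>v. v \<notin> A \<Longrightarrow> \<phi> v * nabla E r f v = 0"
  shows "toeplitz E r \<phi> f = (\<Sum>v\<in>A. (\<lambda>u. \<phi> v * nabla E r f v * path_indicator E r v u))"
proof
  fix u
  have "toeplitz E r \<phi> f u = (\<Sum>\<^sub>\<infinity>v\<in>A \<inter> sector E r u. \<phi> v * nabla E r f v)"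
    unfolding toeplitz_def Delta_def by (rule infsum_cong_neutral) (use assms(2) in auto)
  also have "\<dots> = (\<Sum>v\<in>A \<inter> sector E r u. \<phi> v * nabla E r f v)"
    using assms(1) by simp
  also have "\<dots> = (\<Sum>v\<in>A. \<phi> v * nabla E r f v * path_indicator E r v u)"
    using assms(1) by (intro sum.mono_neutral_cong_left) (auto simp: path_indicator_def)
  also have "\<dots> = (\<Sum>v\<in>A. (\<lambda>u. \<phi> v * nabla E r f v * path_indicator E r v u)) u"
    using assms(1) by (induction A rule: finite_induct) auto
  finally show "toeplitz E r \<phi> f u = \<dots>" .
qed

lemma toeplitz_path_indicator:
  assumes "is_tree E"
  shows "toeplitz E r \<phi> (path_indicator E r v) = (\<lambda>u. \<phi> v * path_indicator E r v u)"
  by (subst toeplitz_finite_support[of "{v}"]) (auto simp: nabla_path_indicator[OF assms])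

section \<open>Subspaces\<close>

lemma finite_support_in_Lp_space:
  assumes "finite {v. f v \<noteq> 0}"
  shows "f \<in> Lp_space p"
proof (cases "p = \<infinity>")
  case True
  have "range f \<subseteq> insert 0 (f ` {v. f v \<noteq> 0})" by auto
  then have "finite (range f)"
    using assms by (meson finite_imageI finite_insert finite_subset)
  then show ?thesis
    using True by (simp add: Lp_space_def finite_imp_bounded)
next
  case False
  have "(\<lambda>v. norm (f v) powr enn2real p) summable_on {v. f v \<noteq> 0}"
    using assms by simp
  \<comment> \<open>Since \<open>0 powr s = 0\<close> for every \<open>s\<close>, the terms off the
    support vanish.\<close>
  then have "(\<lambda>v. norm (f v) powr enn2real p) summable_on UNIV"
    by (rule summable_on_cong_neutral[THEN iffD1, rotated -1]) auto
  then show ?thesis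
    using False by (simp add: Lp_space_def)
qed

lemma path_indicator_in_Lp_space:
  assumes "is_tree E"
  shows "path_indicator E r v \<in> Lp_space p"
proof (rule finite_support_in_Lp_space)
  have "{u. path_indicator E r v u \<noteq> 0} \<subseteq> set (the_path E r v)"
    by (auto simp: path_indicator_def sector_eq[OF assms])
  then show "finite {u. path_indicator E r v u \<noteq> 0}"
    by (rule finite_subset) simp
qed

text \<open>A crude substitute for the Minkowski inequality, obtained from twice the larger norm; it
  is enough for summability.\<close>

lemma norm_add_powr_le:
  fixes a b :: "'a::real_normed_vector"
  assumes "0 \<le> s"
  shows "norm (a + b) powr s \<le> 2 powr s * (norm a powr s + norm b powr s)"
proof -
  have "norm (a + b) \<le> 2 * max (norm a) (norm b)"
    using norm_triangle_ineq[of a b] by linarith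
  then have "norm (a + b) powr s \<le> (2 * max (norm a) (norm b)) powr s"
    using assms by (intro powr_mono2) auto
  also have "\<dots> = 2 powr s * max (norm a) (norm b) powr s"
    by (simp add: powr_mult)
  also have "\<dots> \<le> 2 powr s * (norm a powr s + norm b powr s)"
    by (intro mult_left_mono) (auto simp: max_def)
  finally show ?thesis .
qed

lemma Lp_space_add:
  assumes "f \<in> Lp_space p" "g \<in> Lp_space p"
  shows "(\<lambda>v. f v + g v) \<in> Lp_space p"
proof (cases "p = \<infinity>")
  case True
  then show ?thesis
    using assms bounded_plus_comp[of f UNIV g] by (simp add: Lp_space_def)
next
  case False
  let ?s = "enn2real p"
  have "(\<lambda>v. 2 powr ?s * (norm (f v) powr ?s + norm (g v) powr ?s)) summable_on UNIV"
    using assms False by (intro summable_on_cmult_right summable_on_add) (auto simp: Lp_space_def)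
  then have "(\<lambda>v. norm (f v + g v) powr ?s) summable_on UNIV"
    by (rule summable_on_comparison_test) (auto intro: norm_add_powr_le)
  then show ?thesis
    using False by (simp add: Lp_space_def)
qed

lemma Lp_space_scale:
  assumes "f \<in> Lp_space p"
  shows "(\<lambda>v. c * f v) \<in> Lp_space p"
proof (cases "p = \<infinity>")
  case True
  then have "bounded ((*) c ` range f)"
    using assms by (intro bounded_linear_image bounded_linear_mult_right) (simp add: Lp_space_def)
  then show ?thesis
    using True by (simp add: Lp_space_def image_image)
next
  case False
  then show ?thesis
    using assms by (auto simp: Lp_space_def norm_mult powr_mult intro: summable_on_cmult_right)
qed

lemma subspace_range:
  assumes "bounded_operator_on p A"
  shows "cfun.subspace (A ` Lp_space p)"
proof (rule cfun.subspaceI)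
  have add: "A (\<lambda>v. f v + g v) = (\<lambda>v. A f v + A g v)"
    if "f \<in> Lp_space p" "g \<in> Lp_space p" for f g
    using assms that unfolding bounded_operator_on_def by blast
  have scale: "A (\<lambda>v. c * f v) = (\<lambda>v. c * A f v)" if "f \<in> Lp_space p" for c f
    using assms that unfolding bounded_operator_on_def by blast
  have zero: "(\<lambda>v. 0) \<in> Lp_space p"
    by (rule finite_support_in_Lp_space) simp
  then have "A (\<lambda>v. 0) = 0"
    using scale[of "\<lambda>v. 0" 0] by (simp add: zero_fun_def)
  then show "0 \<in> A ` Lp_space p"
    using zero by (metis imageI)
  show "x + y \<in> A ` Lp_space p" if "x \<in> A ` Lp_space p" "y \<in> A ` Lp_space p" for x y
    using that
  proof (elim imageE)
    fix f g assume "x = A f" "y = A g" and fg: "f \<in> Lp_space p" "g \<in> Lp_space p"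
    then have "x + y = A (\<lambda>v. f v + g v)"
      using add by (simp add: plus_fun_def)
    then show ?thesis
      using Lp_space_add[OF fg] by blast
  qed
  show "(\<lambda>v. c * x v) \<in> A ` Lp_space p" if "x \<in> A ` Lp_space p" for c x
    using that
  proof (elim imageE)
    fix f assume "x = A f" and f: "f \<in> Lp_space p"
    then have "(\<lambda>v. c * x v) = A (\<lambda>v. c * f v)"
      using scale by simp
    then show ?thesis
      using Lp_space_scale[OF f] by blast
  qed
qed

text \<open>\<open>finite_rank_on\<close> asks for a finite set whose span equals the range, whereas
  \<open>B\<close> may leave the range. A maximal independent subset \<open>C\<close> of the range
  is finite because it lies in the span of \<open>B\<close>, and its span stays inside the range,
  which is a subspace.\<close>

lemma finite_rank_onI:
  assumes "bounded_operator_on p A" "finite B" "A ` Lp_space p \<subseteq> cfun.span B"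
  shows "finite_rank_on p A"
proof -
  obtain C where C: "C \<subseteq> A ` Lp_space p" "cfun.independent C" "A ` Lp_space p \<subseteq> cfun.span C"
    using cfun.maximal_independent_subset by blast
  have "finite C"
    using cfun.independent_span_bound[OF \<open>finite B\<close> C(2)] C(1) assms(3) by blast
  moreover have "cfun.span C = A ` Lp_space p"
    using C cfun.span_minimal[OF C(1) subspace_range[OF assms(1)]] by blast
  ultimately show ?thesis
    unfolding finite_rank_on_def by blast
qed

section \<open>Rank and the support of the symbol\<close>

theorem theorem5p1:
  fixes E :: "'a \<Rightarrow> 'a \<Rightarrow> bool" and r :: 'a
    and p q :: ennreal and \<phi> :: "'a \<Rightarrow> complex"
  assumes "is_tree E"
    and "infinite (UNIV :: 'a set)" and "countable (UNIV :: 'a set)"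
    and "\<And>v. \<not> terminal E v"
    and "1 \<le> p" and "1 / p + 1 / q = 1"
    and "\<phi> \<in> Lp_space q" and "tree_derivative E r \<phi> \<in> Lp_space q"
    and "bounded_operator_on p (toeplitz E r \<phi>)"
  shows "finite_rank_on p (toeplitz E r \<phi>) \<longleftrightarrow> finite {v. \<phi> v \<noteq> 0}"
proof
  let ?S = "{v. \<phi> v \<noteq> 0}" and ?\<chi> = "path_indicator E r"
  assume "finite_rank_on p (toeplitz E r \<phi>)"
  then obtain B where B: "finite B" "cfun.span B = toeplitz E r \<phi> ` Lp_space p"
    unfolding finite_rank_on_def by blast
  \<comment> \<open>An eigenvector with nonzero eigenvalue lies in the range: divide its image by
    \<open>\<phi> v\<close>.\<close>
  have "?\<chi> v \<in> cfun.span B" if "\<phi> v \<noteq> 0" for v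
  proof -
    have "toeplitz E r \<phi> (?\<chi> v) \<in> cfun.span B"
      using B path_indicator_in_Lp_space[OF assms(1)] by blast
    then have "(\<lambda>u. (1 / \<phi> v) * toeplitz E r \<phi> (?\<chi> v) u) \<in> cfun.span B"
      by (rule cfun.span_scale)
    moreover have "(\<lambda>u. (1 / \<phi> v) * toeplitz E r \<phi> (?\<chi> v) u) = ?\<chi> v"
      unfolding toeplitz_path_indicator[OF assms(1)] using that by (simp add: fun_eq_iff)
    ultimately show ?thesis by simp
  qed
  then have "?\<chi> ` ?S \<subseteq> cfun.span B"
    by (intro image_subsetI) simp
  \<comment> \<open>An independent set inside the span of a finite set is finite; injectivity then
    carries finiteness back to the vertices.\<close>
  then have "finite (?\<chi> ` ?S)"
    by (rule cfun.independent_span_bound[OF B(1) independent_path_indicators[OF assms(1)],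
          THEN conjunct1])
  then show "finite ?S"
    using inj_on_subset[OF inj_path_indicator[OF assms(1)] subset_UNIV] by (rule finite_imageD)
next
  let ?S = "{v. \<phi> v \<noteq> 0}" and ?\<chi> = "path_indicator E r"
  assume S: "finite ?S"
  show "finite_rank_on p (toeplitz E r \<phi>)"
  proof (rule finite_rank_onI[OF assms(9), of "?\<chi> ` ?S"])
    show "finite (?\<chi> ` ?S)" using S by simp
    show "toeplitz E r \<phi> ` Lp_space p \<subseteq> cfun.span (?\<chi> ` ?S)"
    proof
      fix g assume "g \<in> toeplitz E r \<phi> ` Lp_space p"
      then obtain f where "g = toeplitz E r \<phi> f" by blast
      \<comment> \<open>Off \<open>?S\<close> the product vanishes because \<open>\<phi>\<close>
        does, whatever \<open>f\<close> is.\<close>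
      moreover have "toeplitz E r \<phi> f = (\<Sum>v\<in>?S. (\<lambda>u. \<phi> v * nabla E r f v * ?\<chi> v u))"
        by (rule toeplitz_finite_support[OF S]) simp
      moreover have "\<dots> \<in> cfun.span (?\<chi> ` ?S)"
        by (intro cfun.span_sum cfun.span_scale cfun.span_base imageI)
      ultimately show "g \<in> cfun.span (?\<chi> ` ?S)"
        by metis
    qed
  qed
qed

end
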